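(* Let $h$ and $h'$ be Hessenberg functions with $h>h'$. Then $I_h\subset I_{h'}$ (i.e., $I_h$ is contained in $I_{h'}$).
   Context: A Hessenberg function is an $n$-tuple $h=(h_1,\ldots,h_n)$ of integers with $i\le h_i\le n$ for all $i$ and $h_i\le h_{i+1}$ for $1\le i\le n-1$. Hessenberg functions are partially ordered by $h\le h'$ iff $h_i\le h'_i$ for all $i$; $h>h'$ means $h\ge h'$ and $h\ne h'$. For $S\subseteq\{1,\ldots,n\}$, $e_d(S)$ denotes the sum of all squarefree monomials $x_{i_1}\cdots x_{i_d}$ with $i_1<\cdots<i_d$ in $S$ (with $e_0(S)=1$, $e_d(S)=0$ for $d<0$ or $d>|S|$), and $e_d(1,\ldots,m)$ means $S=\{1,\ldots,m\}$. $I_h$ is the ideal of $\mathbb{Z}[x_1,\ldots,x_n]$ generated by $\mathfrak{C}_h=\{e_{h_i-r}(1,\ldots,h_i): 1\le i\le n,\ 0\le r\le i-1\}$. *)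

theory Defs
  imports "HOL-Library.Poly_Mapping" "HOL-Algebra.Ideal"
begin

text \<open>
  An integer polynomial in variables indexed by the natural numbers is a finitely supported map
  from monomials (finitely supported exponent functions) to coefficients; the multiplication of
  \<^typ>\<open>(nat \<Rightarrow>\<^sub>0 nat) \<Rightarrow>\<^sub>0 int\<close> is convolution, i.e. polynomial multiplication.
\<close>

type_synonym zpoly = "(nat \<Rightarrow>\<^sub>0 nat) \<Rightarrow>\<^sub>0 int"

definition pvar :: "nat \<Rightarrow> zpoly" where
  "pvar i = Poly_Mapping.single (Poly_Mapping.single i 1) 1"

text \<open>The ring of integer polynomials in which only the variables 1, ..., n occur.\<close>

definition poly_ring :: "nat \<Rightarrow> zpoly ring" where
  "poly_ring n =
     \<lparr>carrier = {p. \<forall>m \<in> Poly_Mapping.keys p. Poly_Mapping.keys m \<subseteq> {1..n}},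
      mult = (*), one = 1, zero = 0, add = (+)\<rparr>"

text \<open>
  The degree is an integer, so that degrees below 0 or above the size of the finite set \<open>S\<close>
  give the empty sum.
\<close>

definition esym :: "int \<Rightarrow> nat set \<Rightarrow> zpoly" where
  "esym d S = (\<Sum>A | A \<subseteq> S \<and> int (card A) = d. \<Prod>i\<in>A. pvar i)"

text \<open>
  An n-tuple is represented by the values of a function at 1, ..., n; values elsewhere are
  irrelevant, and equality of tuples is equality at these arguments.
\<close>

definition hessenberg :: "nat \<Rightarrow> (nat \<Rightarrow> nat) \<Rightarrow> bool" where
  "hessenberg n h \<longleftrightarrow>
     (\<forall>i \<in> {1..n}. i \<le> h i \<and> h i \<le> n) \<and>
     (\<forall>i. 1 \<le> i \<and> i < n \<longrightarrow> h i \<le> h (i + 1))"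

definition hess_le :: "nat \<Rightarrow> (nat \<Rightarrow> nat) \<Rightarrow> (nat \<Rightarrow> nat) \<Rightarrow> bool" where
  "hess_le n h h' \<longleftrightarrow> (\<forall>i \<in> {1..n}. h i \<le> h' i)"

definition hess_less :: "nat \<Rightarrow> (nat \<Rightarrow> nat) \<Rightarrow> (nat \<Rightarrow> nat) \<Rightarrow> bool" where
  "hess_less n h h' \<longleftrightarrow> hess_le n h h' \<and> (\<exists>i \<in> {1..n}. h i \<noteq> h' i)"

definition hess_gens :: "nat \<Rightarrow> (nat \<Rightarrow> nat) \<Rightarrow> zpoly set" where
  "hess_gens n h =
     {esym (int (h i) - int r) {1..h i} | i r. 1 \<le> i \<and> i \<le> n \<and> r \<le> i - 1}"

definition hess_ideal :: "nat \<Rightarrow> (nat \<Rightarrow> nat) \<Rightarrow> zpoly set" where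
  "hess_ideal n h = genideal (poly_ring n) (hess_gens n h)"

lemma poly_ring_simps:
  "p \<in> carrier (poly_ring n) \<longleftrightarrow>
     (\<forall>m \<in> Poly_Mapping.keys p. Poly_Mapping.keys m \<subseteq> {1..n})"
  "mult (poly_ring n) = (*)" "one (poly_ring n) = 1"
  "zero (poly_ring n) = 0" "add (poly_ring n) = (+)"
  by (simp_all add: poly_ring_def)

lemma poly_ring_add_closed:
  "p \<in> carrier (poly_ring n) \<Longrightarrow> q \<in> carrier (poly_ring n) \<Longrightarrow> p + q \<in> carrier (poly_ring n)"
  using Poly_Mapping.keys_add[of p q] by (fastforce simp: poly_ring_simps)

lemma poly_ring_uminus_closed:
  "p \<in> carrier (poly_ring n) \<Longrightarrow> - p \<in> carrier (poly_ring n)"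
  by (simp add: poly_ring_simps Poly_Mapping.keys_minus)

lemma poly_ring_mult_closed:
  assumes "p \<in> carrier (poly_ring n)" "q \<in> carrier (poly_ring n)"
  shows "p * q \<in> carrier (poly_ring n)"
proof -
  have "Poly_Mapping.keys m \<subseteq> {1..n}" if mem: "m \<in> Poly_Mapping.keys (p * q)" for m
  proof -
    obtain a b where ab: "m = a + b" "a \<in> Poly_Mapping.keys p" "b \<in> Poly_Mapping.keys q"
      using mem Poly_Mapping.keys_mult[of p q] by blast
    then have "Poly_Mapping.keys a \<subseteq> {1..n}" "Poly_Mapping.keys b \<subseteq> {1..n}"
      using assms by (auto simp: poly_ring_simps)
    then show ?thesis
      using Poly_Mapping.keys_add[of a b] ab(1) by blast
  qed
  then show ?thesis by (simp add: poly_ring_simps)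
qed

lemma poly_ring_zero_one_closed:
  "0 \<in> carrier (poly_ring n)" "1 \<in> carrier (poly_ring n)"
  by (simp_all add: poly_ring_simps)

lemma cring_poly_ring: "cring (poly_ring n)"
proof (rule cringI)
  show "abelian_group (poly_ring n)"
  proof (rule abelian_groupI)
    fix x assume "x \<in> carrier (poly_ring n)"
    then show "\<exists>y\<in>carrier (poly_ring n). y \<oplus>\<^bsub>poly_ring n\<^esub> x = \<zero>\<^bsub>poly_ring n\<^esub>"
      by (intro bexI[of _ "- x"]) (simp_all add: poly_ring_simps(4,5) poly_ring_uminus_closed)
  qed (simp_all add: poly_ring_simps(2-5) poly_ring_add_closed poly_ring_zero_one_closed
        add.assoc add.commute)
  show "comm_monoid (poly_ring n)"
    by (rule comm_monoidI)
      (simp_all add: poly_ring_simps(2-5) poly_ring_mult_closed poly_ring_zero_one_closed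
        mult.assoc mult.commute)
qed (simp add: poly_ring_simps(2-5) distrib_right)

lemma pvar_closed: "1 \<le> i \<Longrightarrow> i \<le> n \<Longrightarrow> pvar i \<in> carrier (poly_ring n)"
  by (simp add: poly_ring_simps pvar_def)

lemma poly_ring_sum_closed:
  "(\<And>a. a \<in> A \<Longrightarrow> f a \<in> carrier (poly_ring n)) \<Longrightarrow> sum f A \<in> carrier (poly_ring n)"
  by (induction A rule: infinite_finite_induct)
    (simp_all add: poly_ring_zero_one_closed poly_ring_add_closed)

lemma poly_ring_prod_closed:
  "(\<And>a. a \<in> A \<Longrightarrow> f a \<in> carrier (poly_ring n)) \<Longrightarrow> prod f A \<in> carrier (poly_ring n)"
  by (induction A rule: infinite_finite_induct)
    (simp_all add: poly_ring_zero_one_closed poly_ring_mult_closed)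

lemma esym_closed: "S \<subseteq> {1..n} \<Longrightarrow> esym d S \<in> carrier (poly_ring n)"
  unfolding esym_def
  by (intro poly_ring_sum_closed poly_ring_prod_closed pvar_closed) auto

lemma hess_gens_closed: "hessenberg n h \<Longrightarrow> hess_gens n h \<subseteq> carrier (poly_ring n)"
  unfolding hess_gens_def hessenberg_def 
  by (fastforce intro!: esym_closed intro: order_trans)

lemma hess_ideal_ideal: "hessenberg n h \<Longrightarrow> ideal (hess_ideal n h) (poly_ring n)"
  unfolding hess_ideal_def
  by (intro ring.genideal_ideal hess_gens_closed cring.axioms(1) cring_poly_ring)

end

theory Submission
  imports Defs
begin

text \<open>
  Pascal's rule $e_d(1,\dots,m+1) = e_d(1,\dots,m) + x_{m+1}\, e_{d-1}(1,\dots,m)$ at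
  $d = m+1-r$ writes $e_{m+1-r}(1,\dots,m+1)$ as a combination of $e_{m-(r-1)}(1,\dots,m)$, which
  vanishes for $r = 0$, and $e_{m-r}(1,\dots,m)$. Hence an ideal that contains
  $e_{m-r}(1,\dots,m)$ for all $r < i$ contains $e_{m+1-r}(1,\dots,m+1)$ for all $r < i$, and one
  climbs from $m = h'_i$ to $m = h_i$.
\<close>

lemma esym_eq_0:
  assumes "finite S" and "int (card S) < d"
  shows "esym d S = 0"
proof -
  have "int (card A) \<noteq> d" if "A \<subseteq> S" for A
    using card_mono[OF assms(1) that] assms(2) by linarith
  then have "{A. A \<subseteq> S \<and> int (card A) = d} = {}" by blast
  then show ?thesis by (simp only: esym_def sum.empty)
qed

text \<open>Sort the \<open>d\<close>-subsets of \<open>insert a S\<close> by whether they contain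
  \<open>a\<close>; removing \<open>a\<close> matches those that do with the
  \<open>(d - 1)\<close>-subsets of \<open>S\<close>. As degrees are integers, \<open>d = 0\<close>
  is no special case: the second sum is then empty.\<close>

lemma esym_insert:
  assumes "finite S" and "a \<notin> S"
  shows "esym d (insert a S) = esym d S + pvar a * esym (d - 1) S"
proof -
  let ?B = "{A. A \<subseteq> S \<and> int (card A) = d - 1}"
  have fin: "finite A" and notin: "a \<notin> A" if "A \<subseteq> S" for A
    using that assms finite_subset by auto
  have split: "{A. A \<subseteq> insert a S \<and> int (card A) = d}
      = {A. A \<subseteq> S \<and> int (card A) = d} \<union> insert a ` ?B"
    (is "?L = ?M \<union> _")
  proof (intro equalityI subsetI)
    fix A assume A: "A \<in> ?L"
    show "A \<in> ?M \<union> insert a ` ?B"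
    proof (cases "a \<in> A")
      case True
      have sub: "A - {a} \<subseteq> S" using A by auto
      have "A = insert a (A - {a})" using True by auto
      moreover from this have "card A = Suc (card (A - {a}))"
        using fin[OF sub] by (metis card_insert_disjoint Diff_iff singletonI)
      ultimately show ?thesis using A sub by (intro UnI2 image_eqI[of _ _ "A - {a}"]) auto
    qed (use A in auto)
  next
    fix A assume "A \<in> ?M \<union> insert a ` ?B"
    then show "A \<in> ?L" using fin notin by auto
  qed
  \<comment> \<open>Members of \<open>?B\<close> avoid \<open>a\<close>, so each is recovered from
    its image; this allows reindexing the sum over the image.\<close>
  have inj: "inj_on (insert a) ?B"
    using notin by (intro inj_onI) (metis (mono_tags, lifting) insert_ident mem_Collect_eq)
  have "esym d (insert a S) = (\<Sum>A\<in>?M \<union> insert a ` ?B. \<Prod>i\<in>A. pvar i)"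
    unfolding esym_def split ..
  also have "\<dots> = esym d S + (\<Sum>A\<in>insert a ` ?B. \<Prod>i\<in>A. pvar i)"
    unfolding esym_def by (rule sum.union_disjoint) (use assms in auto)
  also have "(\<Sum>A\<in>insert a ` ?B. \<Prod>i\<in>A. pvar i) = (\<Sum>A\<in>?B. pvar a * (\<Prod>i\<in>A. pvar i))"
    unfolding sum.reindex[OF inj] by (rule sum.cong) (auto simp: fin notin)
  also have "\<dots> = pvar a * esym (d - 1) S"
    unfolding esym_def by (simp add: sum_distrib_left)
  finally show ?thesis .
qed

text \<open>Passing from \<open>m\<close> to \<open>Suc m\<close> at \<open>r\<close> uses the
  memberships at both \<open>r\<close> and \<open>r - 1\<close>, so the induction treats all
  \<open>r < i\<close> at once.\<close>

lemma esym_mem_ideal_mono: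
  assumes I: "ideal I (poly_ring n)"
    and base: "\<And>r. r < i \<Longrightarrow> esym (int k - int r) {1..k} \<in> I"
    and "k \<le> m" "m \<le> n" "r < i"
  shows "esym (int m - int r) {1..m} \<in> I"
  using \<open>k \<le> m\<close> \<open>m \<le> n\<close> \<open>r < i\<close>
proof (induction m arbitrary: r rule: dec_induct)
  case base
  then show ?case using assms(2) by simp
next
  case (step m)
  interpret I: ideal I "poly_ring n" by (rule I)
  \<comment> \<open>For \<open>r = 0\<close> the degree exceeds the number of variables; for
    \<open>r = Suc s\<close> it equals \<open>m - s\<close>, and the induction hypothesis at
    \<open>s\<close> applies.\<close>
  have "esym (int (Suc m) - int r) {1..m} \<in> I"
  proof (cases r)
    case 0
    then have "esym (int (Suc m) - int r) {1..m} = 0" by (intro esym_eq_0) auto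
    then show ?thesis using additive_subgroup.zero_closed[OF I.is_additive_subgroup] by (simp add: poly_ring_simps)
  next
    case (Suc s)
    then show ?thesis using step.IH[of s] step.prems by simp
  qed
  \<comment> \<open>The new variable lies in the ring because \<open>Suc m\<close> \<le>
    \<open>n\<close>.\<close>
  moreover have "pvar (Suc m) * esym (int m - int r) {1..m} \<in> I"
    using I.I_l_closed[OF step.IH[of r] pvar_closed[of "Suc m"]] step.prems
    by (simp only: poly_ring_simps(2))
  ultimately have "esym (int (Suc m) - int r) {1..m}
      + pvar (Suc m) * esym (int m - int r) {1..m} \<in> I"
    using additive_subgroup.a_closed[OF I.is_additive_subgroup] by (simp only: poly_ring_simps(5))
  moreover have "{1..Suc m} = insert (Suc m) {1..m}" by auto
  moreover have "int (Suc m) - int r - 1 = int m - int r" by simp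
  ultimately show ?case
    by (simp only: esym_insert finite_atLeastAtMost atLeastAtMost_iff Suc_n_not_le_n simp_thms)
qed

theorem theorem4p8:
  fixes n :: nat and h h' :: "nat \<Rightarrow> nat"
  assumes "hessenberg n h" and "hessenberg n h'"
    and "hess_less n h' h"
  shows "hess_ideal n h \<subseteq> hess_ideal n h'"
proof -
  interpret cring "poly_ring n" by (rule cring_poly_ring)
  have "hess_gens n h \<subseteq> hess_ideal n h'"
  proof
    fix p assume "p \<in> hess_gens n h"
    then obtain i r where ir: "1 \<le> i" "i \<le> n" "r \<le> i - 1" and
      p: "p = esym (int (h i) - int r) {1..h i}"
      unfolding hess_gens_def by blast
    \<comment> \<open>The subtraction in \<open>i - 1\<close> is truncated, so this relies on 1
      \<le> \<open>i\<close>.\<close>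
    have "r < i" using ir by simp
    \<comment> \<open>The range of \<open>r\<close> in the generators depends on \<open>i\<close>
      alone, so row \<open>i\<close> of \<open>h'\<close> supplies the whole base of the climb from
      \<open>h' i\<close> to \<open>h i\<close>.\<close>
    have gen: "esym (int (h' i) - int s) {1..h' i} \<in> hess_ideal n h'" if "s < i" for s
    proof -
      have "esym (int (h' i) - int s) {1..h' i} \<in> hess_gens n h'"
        unfolding hess_gens_def using ir that by (intro CollectI exI[of _ i] exI[of _ s]) simp
      then show ?thesis
        unfolding hess_ideal_def using genideal_self hess_gens_closed[OF assms(2)] by blast
    qed
    have le: "h' i \<le> h i" "h i \<le> n"
      using assms ir by (auto simp: hess_less_def hess_le_def hessenberg_def)
    show "p \<in> hess_ideal n h'"
      unfolding p using hess_ideal_ideal[OF assms(2)] gen le \<open>r < i\<close>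
      by (rule esym_mem_ideal_mono)
  qed
  then show ?thesis
    unfolding hess_ideal_def[of n h] by (rule genideal_minimal[OF hess_ideal_ideal[OF assms(2)]])
qed

end
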